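(* Let $k\geq 2$ and $n$ be integers with $2k+1\leq n\leq k^{3}/2+k+1$. Then there exists a graph $G$ of order $n$, with minimum degree $\delta(G)\geq k$, such that $G$ is a proper subgraph of $M_{k}(n)$ and $\lambda(G)>n-k-1$.
   Context: Graphs are finite, simple and undirected. $\lambda(G)$ denotes the spectral radius (largest eigenvalue) of the adjacency matrix of $G$, and $\delta(G)$ its minimum degree. $K_s$ and $\overline{K}_s$ denote the complete graph and the edgeless graph of order $s$; $G\vee H$ denotes the join and $G+H$ the disjoint union of graphs $G$ and $H$. For $k\geq 1$ and $n\geq 2k+1$, \[ M_k(n):=K_k\vee (K_{n-2k}+\overline{K}_k), \] which is a graph of order $n$. *)

theory Defs
  imports
    "Graph_Theory.Pair_Digraph"
    "Graph_Theory.Digraph_Component"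
    "Jordan_Normal_Form.Spectral_Radius"
    "HOL-Library.Countable_Set"
begin

text \<open>
  A finite simple undirected graph is a \<open>pair_graph\<close>: finite vertex set, and an arc relation
  that is irreflexive and symmetric. An edge \<open>uv\<close> is the pair of arcs \<open>(u, v)\<close>, \<open>(v, u)\<close>.
\<close>

definition complete_graph :: "nat \<Rightarrow> nat pair_pre_digraph" where
  "complete_graph s = \<lparr> pverts = {..<s}, parcs = {(u, v). u < s \<and> v < s \<and> u \<noteq> v} \<rparr>"

definition edgeless_graph :: "nat \<Rightarrow> nat pair_pre_digraph" where
  "edgeless_graph s = \<lparr> pverts = {..<s}, parcs = {} \<rparr>"

definition disjoint_union ::
  "'a pair_pre_digraph \<Rightarrow> 'b pair_pre_digraph \<Rightarrow> ('a + 'b) pair_pre_digraph"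
  (infixr \<open>+\<^sub>G\<close> 65) where
  "G +\<^sub>G H =
    \<lparr> pverts = pverts G <+> pverts H,
      parcs = map_prod Inl Inl ` parcs G \<union> map_prod Inr Inr ` parcs H \<rparr>"

definition graph_join ::
  "'a pair_pre_digraph \<Rightarrow> 'b pair_pre_digraph \<Rightarrow> ('a + 'b) pair_pre_digraph"
  (infixr \<open>\<or>\<^sub>G\<close> 60) where
  "G \<or>\<^sub>G H =
    \<lparr> pverts = pverts (G +\<^sub>G H),
      parcs = parcs (G +\<^sub>G H)
        \<union> (Inl ` pverts G) \<times> (Inr ` pverts H) \<union> (Inr ` pverts H) \<times> (Inl ` pverts G) \<rparr>"

definition M_graph :: "nat \<Rightarrow> nat \<Rightarrow> (nat + nat + nat) pair_pre_digraph" where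
  "M_graph k n = complete_graph k \<or>\<^sub>G (complete_graph (n - 2 * k) +\<^sub>G edgeless_graph k)"

definition graph_order :: "'a pair_pre_digraph \<Rightarrow> nat" where
  "graph_order G = card (pverts G)"

text \<open>By symmetry of the arc relation, the degree of a vertex is its out-degree.\<close>

definition min_degree :: "'a pair_pre_digraph \<Rightarrow> nat" where
  "min_degree G = Min (out_degree (with_proj G) ` pverts G)"

text \<open>
  The rows and columns are indexed along the enumeration \<open>from_nat_into\<close> of the vertex set, which
  is a bijection from \<open>{..<graph_order G}\<close>. Another enumeration permutes rows and columns
  simultaneously, so the spectrum does not depend on this choice.
\<close>

definition adjacency_matrix :: "'a pair_pre_digraph \<Rightarrow> 'b::{zero,one} mat" where
  "adjacency_matrix G = mat (graph_order G) (graph_order G)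
    (\<lambda>(i, j). if (from_nat_into (pverts G) i, from_nat_into (pverts G) j) \<in> parcs G then 1 else 0)"

text \<open>
  \<open>spectral_radius\<close> is the maximal modulus of a complex eigenvalue. The adjacency matrix is
  symmetric with nonnegative entries, so this is also its largest eigenvalue.
\<close>

definition graph_spectral_radius :: "'a pair_pre_digraph \<Rightarrow> real" where
  "graph_spectral_radius G = spectral_radius (adjacency_matrix G)"

definition proper_subgraph :: "'a pair_pre_digraph \<Rightarrow> 'a pair_pre_digraph \<Rightarrow> bool" where
  "proper_subgraph G H \<longleftrightarrow> subgraph (with_proj G) (with_proj H) \<and> G \<noteq> H"

lemma pair_graph_M_graph: "pair_graph (M_graph k n)"
proof -
  have "finite (parcs (M_graph k n))"
    by (rule finite_subset[of _ "pverts (M_graph k n) \<times> pverts (M_graph k n)"])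
      (auto simp: M_graph_def graph_join_def disjoint_union_def complete_graph_def
        edgeless_graph_def)
  then show ?thesis
    by unfold_locales
      (auto simp: M_graph_def graph_join_def disjoint_union_def complete_graph_def
        edgeless_graph_def symmetric_def sym_def image_iff)
qed

lemma order_M_graph: "2 * k \<le> n \<Longrightarrow> graph_order (M_graph k n) = n"
  by (simp add: graph_order_def M_graph_def graph_join_def disjoint_union_def complete_graph_def
      edgeless_graph_def card_Plus)

end

theory Submission
  imports Defs
begin

text \<open>
  By the Collatz--Wielandt bound, \<open>\<lambda>(G) > c\<close> as soon as some positive vertex weighting \<open>y\<close> satisfies
  \<open>c y(v) < (\<Sum>w \<sim> v. y(w))\<close> at every vertex \<open>v\<close>. For \<open>n \<ge> 2k + 2\<close> delete from \<open>M\<^sub>k(n)\<close> one edge of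
  \<open>K\<^bsub>n-2k\<^esub>\<close>. With \<open>m = n - k\<close>, weight the vertices of \<open>K\<^sub>k\<close> by \<open>1 + 2/(km)\<close>, the two ends of the
  deleted edge by \<open>m/(m + 1)\<close>, the other vertices of \<open>K\<^bsub>n-2k\<^esub>\<close> by \<open>1\<close> and the remaining ones by
  \<open>k/(m - 1)\<close>; at the vertices of \<open>K\<^sub>k\<close> the inequality for \<open>c = m - 1\<close> is where
  \<open>2(m - 1) \<le> k\<^sup>3\<close> enters. For \<open>n = 2k + 1\<close> delete an edge of \<open>K\<^sub>k\<close> instead, with weights \<open>5/4\<close> on
  \<open>K\<^sub>k\<close> and \<open>1\<close> elsewhere. Neither deletion affects the edges between \<open>K\<^sub>k\<close> and the rest, and
  those alone already force all degrees to be at least \<open>k\<close>.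
\<close>

section \<open>Powers of nonnegative matrices and the Collatz--Wielandt bound\<close>

lemma pow_mat_nonneg:
  fixes A :: "'a :: linordered_semidom mat"
  assumes A: "A \<in> carrier_mat n n"
    and nonneg: "\<And>i j. i < n \<Longrightarrow> j < n \<Longrightarrow> 0 \<le> A $$ (i, j)"
    and "i < n" "j < n"
  shows "0 \<le> (A ^\<^sub>m l) $$ (i, j)"
  using assms(3,4)
proof (induction l arbitrary: i j)
  case 0
  then show ?case using A by (simp add: one_mat_def)
next
  case (Suc l)
  then show ?case
    using A by (auto simp: scalar_prod_def intro!: sum_nonneg mult_nonneg_nonneg nonneg)
qed

text \<open>Since \<open>A ^\<^sub>m l\<close> is nonnegative, it may be applied to both sides of
  the entrywise inequality between \<open>q * y\<close> and \<open>A\<close> applied to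
  \<open>y\<close>; this raises the exponent by one.\<close>

lemma pow_mat_weighted_row_sum_ge:
  fixes A :: "'a :: linordered_semidom mat"
  assumes A: "A \<in> carrier_mat n n"
    and nonneg: "\<And>i j. i < n \<Longrightarrow> j < n \<Longrightarrow> 0 \<le> A $$ (i, j)"
    and "0 \<le> q"
    and ge: "\<And>i. i < n \<Longrightarrow> q * y i \<le> (\<Sum>j<n. A $$ (i, j) * y j)"
    and "i < n"
  shows "q ^ l * y i \<le> (\<Sum>j<n. (A ^\<^sub>m l) $$ (i, j) * y j)"
proof (induction l)
  case 0
  have "(\<Sum>j<n. (A ^\<^sub>m 0) $$ (i, j) * y j) = (\<Sum>j<n. if j = i then y j else 0)"
    using A \<open>i < n\<close> by (intro sum.cong) (auto simp: one_mat_def)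
  then show ?case using \<open>i < n\<close> by simp
next
  case (Suc l)
  have "q ^ Suc l * y i \<le> q * (\<Sum>j<n. (A ^\<^sub>m l) $$ (i, j) * y j)"
    using mult_left_mono[OF Suc \<open>0 \<le> q\<close>] by (simp add: mult.assoc)
  also have "\<dots> = (\<Sum>j<n. (A ^\<^sub>m l) $$ (i, j) * (q * y j))"
    by (simp add: sum_distrib_left mult.left_commute)
  also have "\<dots> \<le> (\<Sum>j<n. (A ^\<^sub>m l) $$ (i, j) * (\<Sum>h<n. A $$ (j, h) * y h))"
    using ge pow_mat_nonneg[OF A nonneg \<open>i < n\<close>]
    by (intro sum_mono mult_left_mono) auto
  also have "\<dots> = (\<Sum>h<n. (\<Sum>j<n. (A ^\<^sub>m l) $$ (i, j) * A $$ (j, h)) * y h)"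
    unfolding sum_distrib_left sum_distrib_right
    by (subst sum.swap) (simp add: mult.assoc)
  also have "\<dots> = (\<Sum>h<n. (A ^\<^sub>m Suc l) $$ (i, h) * y h)"
    using A \<open>i < n\<close> by (intro sum.cong) (auto simp: scalar_prod_def atLeast0LessThan)
  finally show ?case .
qed

text \<open>For \<open>a \<noteq> 0\<close>, an eigenvector of the scaled matrix for
  \<open>e\<close> is one of \<open>A\<close> for \<open>e / a\<close>; for \<open>a = 0\<close> the
  only eigenvalue is \<open>0\<close>. This serves to normalise a matrix to spectral radius below
  \<open>1\<close>.\<close>

lemma spectral_radius_smult_le:
  fixes A :: "complex mat"
  assumes A: "A \<in> carrier_mat n n" and "0 < n"
  shows "spectral_radius (a \<cdot>\<^sub>m A) \<le> norm a * spectral_radius A"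
proof -
  have aA: "a \<cdot>\<^sub>m A \<in> carrier_mat n n" using A by simp
  obtain e where e: "eigenvalue (a \<cdot>\<^sub>m A) e" and sr: "spectral_radius (a \<cdot>\<^sub>m A) = norm e"
    using spectral_radius_mem_max(1)[OF aA \<open>0 < n\<close>] by (auto simp: spectrum_def)
  then obtain v where v: "v \<in> carrier_vec n" "v \<noteq> 0\<^sub>v n" "(a \<cdot>\<^sub>m A) *\<^sub>v v = e \<cdot>\<^sub>v v"
    using A unfolding eigenvalue_def eigenvector_def by auto
  have "a \<cdot>\<^sub>v (A *\<^sub>v v) = (a \<cdot>\<^sub>m A) *\<^sub>v v"
    using v(1) A by (intro eq_vecI) (auto simp: scalar_prod_def sum_distrib_left mult.assoc)
  then have av: "a \<cdot>\<^sub>v (A *\<^sub>v v) = e \<cdot>\<^sub>v v"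
    using v(3) by simp
  show ?thesis
  proof (cases "a = 0")
    case True
    then have "e * v $ i = 0" if "i < n" for i
      using arg_cong[OF av, of "\<lambda>w. w $ i"] that v(1) A by simp
    then have "e = 0"
      using v(1,2) by (auto simp: vec_eq_iff)
    then show ?thesis using True sr by simp
  next
    case False
    have "A *\<^sub>v v = (e / a) \<cdot>\<^sub>v v"
      using arg_cong[OF av, of "\<lambda>w. (1 / a) \<cdot>\<^sub>v w"] False by (simp add: smult_smult_assoc)
    then have "eigenvalue A (e / a)"
      using v A unfolding eigenvalue_def eigenvector_def by auto
    then have "norm (e / a) \<le> spectral_radius A"
      using spectral_radius_mem_max(2)[OF A \<open>0 < n\<close>] by (auto simp: spectrum_def)
    then show ?thesis
      using False sr by (simp add: norm_divide field_simps)
  qed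
qed

text \<open>If the spectral radius were at most \<open>c\<close>, a suitable scaling of
  \<open>A\<close> would have bounded powers, whereas the weighted row sums of these powers grow
  geometrically.\<close>

lemma spectral_radius_gt_Collatz_Wielandt:
  fixes A :: "real mat"
  assumes A: "A \<in> carrier_mat n n" and "0 < n"
    and nonneg: "\<And>i j. i < n \<Longrightarrow> j < n \<Longrightarrow> 0 \<le> A $$ (i, j)"
    and y: "\<And>i. i < n \<Longrightarrow> 0 < y i"
    and "0 \<le> c"
    and gt: "\<And>i. i < n \<Longrightarrow> c * y i < (\<Sum>j<n. A $$ (i, j) * y j)"
  shows "c < spectral_radius (map_mat complex_of_real A)"
proof (rule ccontr)
  assume "\<not> ?thesis"
  then have le: "spectral_radius (map_mat complex_of_real A) \<le> c" by simp
  \<comment> \<open>As there are finitely many rows, the strict inequalities leave a uniform gap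
    above \<open>c\<close>.\<close>
  define c' where "c' = Min ((\<lambda>i. (\<Sum>j<n. A $$ (i, j) * y j) / y i) ` {..<n})"
  have "c < c'"
    unfolding c'_def using \<open>0 < n\<close> gt y by (subst Min_gr_iff) (auto simp: field_simps)
  have c': "c' * y i \<le> (\<Sum>j<n. A $$ (i, j) * y j)" if "i < n" for i
  proof -
    have "c' \<le> (\<Sum>j<n. A $$ (i, j) * y j) / y i"
      unfolding c'_def using that by (intro Min_le) auto
    then show ?thesis using y[OF that] by (simp add: field_simps)
  qed
  \<comment> \<open>Scaling by \<open>1 / d\<close> needs room on both sides: \<open>c < d\<close>
    bounds the powers, \<open>d < c'\<close> makes the row sums grow.\<close>
  define d where "d = (c + c') / 2"
  have d: "0 < d" "c < d" "d < c'" using \<open>c < c'\<close> \<open>0 \<le> c\<close> by (auto simp: d_def)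
  define B where "B = (1 / d) \<cdot>\<^sub>m A"
  have B: "B \<in> carrier_mat n n" using A by (simp add: B_def)
  define C where "C = map_mat complex_of_real B"
  have C: "C \<in> carrier_mat n n" using B by (simp add: C_def)
  have "C = complex_of_real (1 / d) \<cdot>\<^sub>m map_mat complex_of_real A"
    by (auto simp: C_def B_def)
  then have "spectral_radius C
      \<le> norm (complex_of_real (1 / d)) * spectral_radius (map_mat complex_of_real A)"
    using spectral_radius_smult_le[of "map_mat complex_of_real A" n] A \<open>0 < n\<close> by simp
  also have "\<dots> \<le> 1 / d * c"
    using le d by (simp add: norm_divide divide_right_mono)
  also have "\<dots> < 1" using d by simp
  \<comment> \<open>One constant bounds all entries of all powers of \<open>C\<close>.\<close>
  finally obtain b where b: "\<And>l. norm_bound (C ^\<^sub>m l) b"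
    using spectral_radius_jnf_norm_bound_less_1_upper_triangular[OF C] by blast
  define S where "S = (\<Sum>j<n. y j)"
  have upper: "(c' / d) ^ l * y 0 \<le> b * S" for l
  proof -
    have "(c' / d) ^ l * y 0 \<le> (\<Sum>j<n. (B ^\<^sub>m l) $$ (0, j) * y j)"
    proof (rule pow_mat_weighted_row_sum_ge[OF B])
      fix i assume "i < n"
      have "c' / d * y i \<le> (\<Sum>j<n. A $$ (i, j) * y j) / d"
        using c'[OF \<open>i < n\<close>] d by (simp add: divide_right_mono)
      also have "\<dots> = (\<Sum>j<n. B $$ (i, j) * y j)"
        using A \<open>i < n\<close> by (auto simp: B_def sum_divide_distrib intro!: sum.cong)
      finally show "c' / d * y i \<le> (\<Sum>j<n. B $$ (i, j) * y j)" .
    qed (use A d nonneg \<open>0 < n\<close> in \<open>auto simp: B_def\<close>)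
    also have "\<dots> \<le> (\<Sum>j<n. b * y j)"
    proof (intro sum_mono mult_right_mono)
      fix j assume j: "j \<in> {..<n}"
      \<comment> \<open>The bound concerns complex powers, the growth real ones; the embedding
        commutes with powers.\<close>
      have pow: "C ^\<^sub>m l = map_mat complex_of_real (B ^\<^sub>m l)"
        unfolding C_def by (rule of_real_hom.mat_hom_pow[OF B, symmetric])
      have Bl: "dim_row (B ^\<^sub>m l) = n" "dim_col (B ^\<^sub>m l) = n"
        using pow_carrier_mat[OF B, of l] by auto
      have "norm ((C ^\<^sub>m l) $$ (0, j)) \<le> b"
        using b[of l] j \<open>0 < n\<close> Bl unfolding pow norm_bound_def
        by (simp del: index_map_mat(1))
      then show "(B ^\<^sub>m l) $$ (0, j) \<le> b"
        using j \<open>0 < n\<close> Bl unfolding pow by auto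
      show "0 \<le> y j" using y j by (simp add: less_imp_le)
    qed
    also have "\<dots> = b * S" by (simp add: S_def sum_distrib_left)
    finally show ?thesis .
  qed
  have "1 < c' / d" using d by simp
  then obtain l where "b * S / y 0 < (c' / d) ^ l" using real_arch_pow by blast
  then have "b * S < (c' / d) ^ l * y 0"
    using y[OF \<open>0 < n\<close>] by (simp add: field_simps)
  with upper[of l] show False by simp
qed

text \<open>Reindexing along the vertex enumeration turns the row sums of the adjacency matrix into
  sums over neighbours.\<close>

lemma graph_spectral_radius_gt:
  assumes fin: "finite (pverts G)" and ne: "pverts G \<noteq> {}"
    and y: "\<And>v. v \<in> pverts G \<Longrightarrow> 0 < y v"
    and "0 \<le> c"
    and gt: "\<And>v. v \<in> pverts G \<Longrightarrow>
      c * y v < (\<Sum>w\<in>pverts G. if (v, w) \<in> parcs G then y w else 0)"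
  shows "c < graph_spectral_radius G"
proof -
  let ?n = "graph_order G"
  let ?f = "from_nat_into (pverts G)"
  have bij: "bij_betw ?f {..<?n} (pverts G)"
    unfolding graph_order_def by (rule bij_betw_from_nat_into_finite[OF fin])
  have in_verts: "?f i \<in> pverts G" for i using ne by (rule from_nat_into)
  have n: "0 < ?n" using fin ne by (simp add: graph_order_def card_gt_0_iff)
  have "c < spectral_radius (map_mat complex_of_real (adjacency_matrix G))"
  proof (rule spectral_radius_gt_Collatz_Wielandt[where n = ?n and y = "y \<circ> ?f"])
    fix i assume i: "i < ?n"
    have "c * y (?f i) < (\<Sum>w\<in>pverts G. if (?f i, w) \<in> parcs G then y w else 0)"
      by (rule gt[OF in_verts])
    also have "\<dots> = (\<Sum>j<?n. if (?f i, ?f j) \<in> parcs G then y (?f j) else 0)"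
      by (rule sum.reindex_bij_betw[OF bij, symmetric])
    also have "\<dots> = (\<Sum>j<?n. adjacency_matrix G $$ (i, j) * (y \<circ> ?f) j)"
      using i by (intro sum.cong) (auto simp: adjacency_matrix_def)
    finally show "c * (y \<circ> ?f) i < (\<Sum>j<?n. adjacency_matrix G $$ (i, j) * (y \<circ> ?f) j)"
      by simp
  qed (use n y in_verts \<open>0 \<le> c\<close> in \<open>auto simp: adjacency_matrix_def\<close>)
  \<comment> \<open>The left matrix has real entries, the right one complex entries.\<close>
  also have "map_mat complex_of_real (adjacency_matrix G) = adjacency_matrix G"
    by (auto simp: adjacency_matrix_def)
  finally show ?thesis by (simp add: graph_spectral_radius_def)
qed

section \<open>Edge deletion\<close>

definition delete_edge :: "'a pair_pre_digraph \<Rightarrow> 'a \<Rightarrow> 'a \<Rightarrow> 'a pair_pre_digraph" where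
  "delete_edge G u v = \<lparr> pverts = pverts G, parcs = parcs G - {(u, v), (v, u)} \<rparr>"

lemma pverts_delete_edge [simp]: "pverts (delete_edge G u v) = pverts G"
  by (simp add: delete_edge_def)

lemma parcs_delete_edge [simp]: "parcs (delete_edge G u v) = parcs G - {(u, v), (v, u)}"
  by (simp add: delete_edge_def)

lemma pair_graph_delete_edge:
  assumes "pair_graph G"
  shows "pair_graph (delete_edge G u v)"
proof -
  interpret pair_graph G by fact
  show ?thesis
    using pair_sym_arcs pair_no_loops pair_finite_verts pair_finite_arcs
      arc_fst_in_verts arc_snd_in_verts
    by unfold_locales (auto simp: symmetric_def sym_def)
qed

lemma proper_subgraph_delete_edge:
  assumes "pair_graph G" and "(u, v) \<in> parcs G"
  shows "proper_subgraph (delete_edge G u v) G"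
proof -
  have "pair_wf_digraph G" "pair_wf_digraph (delete_edge G u v)"
    using assms(1) pair_graph_delete_edge[OF assms(1)]
    by (auto simp: pair_graph_def pair_digraph_def pair_fin_digraph_def)
  moreover have "delete_edge G u v \<noteq> G"
    using assms(2) by (metis DiffE insertCI parcs_delete_edge)
  ultimately show ?thesis
    by (auto simp: proper_subgraph_def subgraph_def wf_digraph_wp_iff compatible_def)
qed

section \<open>Block structure and minimum degree of \<open>M_graph\<close>\<close>

lemma pverts_M_graph: "pverts (M_graph k n) = {..<k} <+> ({..<n - 2 * k} <+> {..<k})"
  by (auto simp: M_graph_def graph_join_def disjoint_union_def complete_graph_def
      edgeless_graph_def)

lemma parcs_M_graph_iff:
  "(Inl i, Inl i') \<in> parcs (M_graph k n) \<longleftrightarrow> i < k \<and> i' < k \<and> i \<noteq> i'"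
  "(Inl i, Inr (Inl j)) \<in> parcs (M_graph k n) \<longleftrightarrow> i < k \<and> j < n - 2 * k"
  "(Inl i, Inr (Inr l)) \<in> parcs (M_graph k n) \<longleftrightarrow> i < k \<and> l < k"
  "(Inr (Inl j), Inl i) \<in> parcs (M_graph k n) \<longleftrightarrow> i < k \<and> j < n - 2 * k"
  "(Inr (Inl j), Inr (Inl j')) \<in> parcs (M_graph k n) \<longleftrightarrow> j < n - 2 * k \<and> j' < n - 2 * k \<and> j \<noteq> j'"
  "(Inr (Inl j), Inr (Inr l)) \<notin> parcs (M_graph k n)"
  "(Inr (Inr l), Inl i) \<in> parcs (M_graph k n) \<longleftrightarrow> i < k \<and> l < k"
  "(Inr (Inr l), Inr (Inl j)) \<notin> parcs (M_graph k n)"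
  "(Inr (Inr l), Inr (Inr l')) \<notin> parcs (M_graph k n)"
  by (auto simp: M_graph_def graph_join_def disjoint_union_def complete_graph_def
      edgeless_graph_def)

lemma sum_pverts_M_graph:
  "(\<Sum>w\<in>pverts (M_graph k n). f w)
    = (\<Sum>i<k. f (Inl i)) + (\<Sum>j<n - 2 * k. f (Inr (Inl j))) + (\<Sum>l<k. f (Inr (Inr l)))"
  by (simp add: pverts_M_graph sum.Plus add.assoc)

text \<open>Exhibiting \<open>k\<close> neighbours of each vertex avoids computing exact
  degrees.\<close>

lemma min_degree_geI:
  assumes "pair_graph G" and "pverts G \<noteq> {}"
    and "\<And>v. v \<in> pverts G \<Longrightarrow> \<exists>W. card W = k \<and> {v} \<times> W \<subseteq> parcs G"
  shows "k \<le> min_degree G"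
proof -
  interpret pair_graph G by fact
  have "k \<le> out_degree (with_proj G) v" if "v \<in> pverts G" for v
  proof -
    obtain W where W: "card W = k" "{v} \<times> W \<subseteq> parcs G" using assms(3)[OF \<open>v \<in> pverts G\<close>] by blast
    have "k = card ({v} \<times> W)" using W(1) by (simp add: card_cartesian_product_singleton)
    also have "\<dots> \<le> out_degree (with_proj G) v"
      unfolding out_degree_def out_arcs_def using W(2) pair_finite_arcs
      by (intro card_mono) auto
    finally show ?thesis .
  qed
  then show ?thesis
    unfolding min_degree_def using pair_finite_verts assms(2) by (subst Min_ge_iff) auto
qed

text \<open>By \<open>isl u = isl v\<close> no edge across the join is lost: vertices of the core
  \<open>K\<^sub>k\<close> keep the \<open>k\<close> independent vertices as neighbours, all others
  keep the core.\<close>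

lemma min_degree_delete_edge_M_graph:
  assumes "k \<ge> 1" and "isl u = isl v"
  shows "k \<le> min_degree (delete_edge (M_graph k n) u v)"
proof (rule min_degree_geI)
  fix w assume w: "w \<in> pverts (delete_edge (M_graph k n) u v)"
  show "\<exists>W. card W = k \<and> {w} \<times> W \<subseteq> parcs (delete_edge (M_graph k n) u v)"
  proof (cases w)
    case (Inl i)
    then show ?thesis
      using w assms(2)
      by (intro exI[of _ "(Inr \<circ> Inr) ` {..<k}"])
        (auto simp: card_image inj_on_def parcs_M_graph_iff pverts_M_graph)
  next
    case (Inr x)
    then show ?thesis
      using w assms(2)
      by (intro exI[of _ "Inl ` {..<k}"])
        (auto simp: card_image parcs_M_graph_iff pverts_M_graph)
  qed
qed (use assms(1) in \<open>auto simp: pair_graph_delete_edge pair_graph_M_graph pverts_M_graph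
    lessThan_empty_iff\<close>)

section \<open>Spectral bounds for the two deletions\<close>

lemma sum_lessThan_if_neq:
  fixes f :: "nat \<Rightarrow> 'a :: ab_group_add"
  assumes "i < n"
  shows "(\<Sum>j<n. if i \<noteq> j then f j else 0) = sum f {..<n} - f i"
proof -
  have "(\<Sum>j<n. if i \<noteq> j then f j else 0) = sum f ({..<n} - {i})"
    by (rule sum.mono_neutral_cong_right) auto
  then show ?thesis using assms by (simp add: sum_diff1)
qed

lemma sum_lessThan_if_less_2:
  fixes a b :: real
  assumes "2 \<le> n"
  shows "(\<Sum>j<n. if j < 2 then a else b) = 2 * a + (real n - 2) * b"
proof -
  obtain p where "n = Suc (Suc p)" using assms by (metis add_2_eq_Suc le_Suc_ex)
  then show ?thesis by (simp del: sum.lessThan_Suc add: sum.lessThan_Suc_shift)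
qed

text \<open>With the weights \<open>a\<close>, \<open>b\<close>, \<open>1\<close>, \<open>t\<close>,
  the inequality has slack at least \<open>2/m - 2/(m + 1)\<close> at the core, the endpoints and
  the rest of the clique, and slack \<open>2/m\<close> at the independent vertices.\<close>

lemma spectral_radius_M_graph_delete_clique_edge:
  fixes k n :: nat
  assumes k: "k \<ge> 2" and n: "2 * k + 2 \<le> n"
    and bound: "real n \<le> real k ^ 3 / 2 + real k + 1"
  shows "real n - real k - 1
    < graph_spectral_radius (delete_edge (M_graph k n) (Inr (Inl 0)) (Inr (Inl 1)))"
    (is "_ < graph_spectral_radius ?G")
proof -
  define m where "m = real n - real k"
  define a where "a = 1 + 2 / (real k * m)"
  define b where "b = m / (m + 1)"
  define t where "t = real k / (m - 1)"
  define y :: "nat + nat + nat \<Rightarrow> real" where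
    "y = case_sum (\<lambda>_. a) (case_sum (\<lambda>j. if j < 2 then b else 1) (\<lambda>_. t))"
  have y_simps: "y (Inl i) = a" "y (Inr (Inl j)) = (if j < 2 then b else 1)" "y (Inr (Inr l)) = t"
    for i j l by (simp_all add: y_def)
  have k': "real k \<ge> 2" using k by simp
  have m: "m \<ge> real k + 2" using n by (simp add: m_def)
  have n2k: "real (n - 2 * k) = m - real k" "2 \<le> n - 2 * k"
    using n by (auto simp: m_def)
  have ka: "real k * a = real k + 2 / m"
    using k' m by (simp add: a_def field_simps)
  have b: "b = 1 - 1 / (m + 1)" using m k' by (simp add: b_def field_simps)
  have frac: "1 / (m + 1) < 1 / m" using m k' by (simp add: field_simps)
  \<comment> \<open>Clearing denominators, this is \<open>2 * (m - 1) \<le> real k ^ 3\<close>, that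
    is, \<open>bound\<close>.\<close>
  have kt: "2 / real k \<le> real k * t"
  proof -
    have "2 * (m - 1) \<le> real k ^ 3" using bound by (simp add: m_def)
    then show ?thesis using m k' by (simp add: t_def field_simps power3_eq_cube)
  qed
  have "m - 1 < graph_spectral_radius ?G"
  proof (rule graph_spectral_radius_gt[where y = y])
    fix v assume "v \<in> pverts ?G"
    then show "0 < y v"
      using m k' by (auto simp: pverts_M_graph y_simps a_def b_def t_def intro!: add_pos_nonneg)
  next
    fix v assume "v \<in> pverts ?G"
    then consider (K) i where "v = Inl i" "i < k"
      | (endpoint) j where "v = Inr (Inl j)" "j < 2"
      | (clique) j where "v = Inr (Inl j)" "2 \<le> j" "j < n - 2 * k"
      | (indep) l where "v = Inr (Inr l)" "l < k"
      by (force simp: pverts_M_graph not_less)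
    then show "(m - 1) * y v < (\<Sum>w\<in>pverts ?G. if (v, w) \<in> parcs ?G then y w else 0)"
    proof cases
      case K
      have "(\<Sum>w\<in>pverts ?G. if (v, w) \<in> parcs ?G then y w else 0)
          = (real k * a - a) + (2 * b + (m - real k - 2)) + real k * t"
        using K n2k
        by (simp add: sum_pverts_M_graph parcs_M_graph_iff y_simps sum_lessThan_if_less_2
            sum_lessThan_if_neq cong: sum.cong_simp)
      \<comment> \<open>The surplus \<open>2 / real k\<close> is paid for by the independent
        vertices, which contribute \<open>real k * t\<close>.\<close>
      moreover have "m * a = m + 2 / real k" using k' m by (simp add: a_def field_simps)
      ultimately show ?thesis using kt ka b frac K by (simp add: y_simps algebra_simps)
    next
      case endpoint
      \<comment> \<open>Both indices below \<open>2\<close> drop out of the clique sum: one is the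
        vertex itself, the other the far end of the deleted edge.\<close>
      have "(\<Sum>w\<in>pverts ?G. if (v, w) \<in> parcs ?G then y w else 0)
          = real k * a + (\<Sum>j<n - 2 * k. if j < 2 then 0 else 1)"
        using endpoint n2k n
        by (auto simp: sum_pverts_M_graph parcs_M_graph_iff y_simps less_2_cases_iff
            intro!: sum.cong arg_cong2[of _ _ _ _ "(+)"])
      also have "\<dots> = real k * a + (m - real k - 2)"
        using n2k by (simp add: sum_lessThan_if_less_2)
      finally have "(\<Sum>w\<in>pverts ?G. if (v, w) \<in> parcs ?G then y w else 0)
          = real k * a + (m - real k - 2)" .
      moreover have "(m - 1) * b = m - 2 * b" using m k' by (simp add: b_def field_simps)
      ultimately show ?thesis using ka b frac endpoint by (simp add: y_simps)
    next
      case clique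
      have "(\<Sum>w\<in>pverts ?G. if (v, w) \<in> parcs ?G then y w else 0)
          = real k * a + (2 * b + (m - real k - 2) - 1)"
        using clique n2k
        by (simp add: sum_pverts_M_graph parcs_M_graph_iff y_simps sum_lessThan_if_less_2
            sum_lessThan_if_neq cong: sum.cong_simp)
      then show ?thesis using ka b frac clique by (simp add: y_simps)
    next
      case indep
      have "(\<Sum>w\<in>pverts ?G. if (v, w) \<in> parcs ?G then y w else 0) = real k * a"
        using indep by (simp add: sum_pverts_M_graph parcs_M_graph_iff y_simps cong: sum.cong_simp)
      \<comment> \<open>Since \<open>(m - 1) * t = real k\<close>, the excess \<open>2 / m\<close>
        of \<open>real k * a\<close> over \<open>real k\<close> is the whole slack.\<close>
      moreover have "0 < 2 / m" using m k' by simp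
      ultimately show ?thesis using ka indep m k' by (simp add: y_simps t_def)
    qed
  qed (use k m in \<open>auto simp: pverts_M_graph lessThan_empty_iff\<close>)
  then show ?thesis by (simp add: m_def)
qed

lemma spectral_radius_M_graph_delete_core_edge:
  fixes k :: nat
  assumes k: "k \<ge> 2"
  shows "real k < graph_spectral_radius (delete_edge (M_graph k (2 * k + 1)) (Inl 0) (Inl 1))"
    (is "_ < graph_spectral_radius ?G")
proof -
  define y :: "nat + nat + nat \<Rightarrow> real" where "y = case_sum (\<lambda>_. 5 / 4) (\<lambda>_. 1)"
  have y_simps: "y (Inl i) = 5 / 4" "y (Inr x) = 1" for i x by (simp_all add: y_def)
  have k': "real k \<ge> 2" using k by simp
  show ?thesis
  proof (rule graph_spectral_radius_gt[where y = y])
    fix v assume "v \<in> pverts ?G"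
    then show "0 < y v" by (auto simp: pverts_M_graph y_simps)
  next
    fix v assume "v \<in> pverts ?G"
    then consider (endpoint) i where "v = Inl i" "i < 2"
      | (core) i where "v = Inl i" "2 \<le> i" "i < k"
      | (rest) x where "v = Inr x" "v \<in> pverts ?G"
      by (force simp: pverts_M_graph not_less)
    then show "real k * y v < (\<Sum>w\<in>pverts ?G. if (v, w) \<in> parcs ?G then y w else 0)"
    proof cases
      case endpoint
      have "(\<Sum>w\<in>pverts ?G. if (v, w) \<in> parcs ?G then y w else 0)
          = (\<Sum>i<k. if i < 2 then 0 else 5 / 4) + 1 + real k"
        using endpoint k
        by (auto simp: sum_pverts_M_graph parcs_M_graph_iff y_simps less_2_cases_iff
            intro!: sum.cong)
      also have "\<dots> = (real k - 2) * (5 / 4) + 1 + real k"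
        using k by (simp add: sum_lessThan_if_less_2)
      finally show ?thesis using endpoint k' by (simp add: y_simps field_simps)
    next
      case core
      have "(\<Sum>w\<in>pverts ?G. if (v, w) \<in> parcs ?G then y w else 0)
          = (real k * (5 / 4) - 5 / 4) + 1 + real k"
        using core
        by (simp add: sum_pverts_M_graph parcs_M_graph_iff y_simps sum_lessThan_if_neq
            cong: sum.cong_simp)
      then show ?thesis using core k' by (simp add: y_simps)
    next
      case rest
      then consider (w) "v = Inr (Inl 0)" | (indep) l where "v = Inr (Inr l)" "l < k"
        by (auto simp: pverts_M_graph)
      then have "(\<Sum>w\<in>pverts ?G. if (v, w) \<in> parcs ?G then y w else 0) = real k * (5 / 4)"
        by cases (simp_all add: sum_pverts_M_graph parcs_M_graph_iff y_simps cong: sum.cong_simp)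
      then show ?thesis using rest k' by (simp add: y_simps)
    qed
  qed (use k in \<open>auto simp: pverts_M_graph lessThan_empty_iff\<close>)
qed

theorem proposition8:
  fixes k n :: nat
  assumes "k \<ge> 2"
    and "2 * k + 1 \<le> n"
    and "real n \<le> real k ^ 3 / 2 + real k + 1"
  shows "\<exists>G. pair_graph G \<and> graph_order G = n \<and> min_degree G \<ge> k
    \<and> proper_subgraph G (M_graph k n)
    \<and> graph_spectral_radius G > real n - real k - 1"
proof -
  \<comment> \<open>All but the spectral bound holds for any edge with both ends on the same side of
    the join, so only the choice of the edge remains.\<close>
  have good: ?thesis
    if "(u, v) \<in> parcs (M_graph k n)" "isl u = isl v"
      "real n - real k - 1 < graph_spectral_radius (delete_edge (M_graph k n) u v)" for u v
  proof (intro exI conjI)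
    show "graph_order (delete_edge (M_graph k n) u v) = n"
      using order_M_graph[of k n] assms(2) by (simp add: graph_order_def)
  qed (use that assms(1) in \<open>auto simp: pair_graph_delete_edge pair_graph_M_graph
      proper_subgraph_delete_edge min_degree_delete_edge_M_graph\<close>)
  show ?thesis
  proof (cases "n = 2 * k + 1")
    case True
    show ?thesis
      by (rule good[of "Inl 0" "Inl 1"])
        (use assms(1) True spectral_radius_M_graph_delete_core_edge[OF assms(1)]
          in \<open>auto simp: parcs_M_graph_iff\<close>)
  next
    case False
    then have "2 * k + 2 \<le> n" using assms(2) by simp
    then show ?thesis
      by (intro good[of "Inr (Inl 0)" "Inr (Inl 1)"])
        (use spectral_radius_M_graph_delete_clique_edge[OF assms(1) _ assms(3)]
          in \<open>auto simp: parcs_M_graph_iff\<close>)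
  qed
qed

end
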